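(* Let $\delta\ge1$ be an integer and $n\ge0$. For every $k$ that is the degree of some vertex of $\mathcal{W}_n$, the average degree of nearest neighbors for vertices with degree $k$ in $\mathcal{W}_n$ is $$\begin{aligned}k_{\rm nn}(k) &= \frac{(\delta+1)(\delta+2)^{2n}(\delta+4)^{1-n}\left(\frac{(\delta+1)k-2\delta}{2} \right)^{\frac{\ln(\delta+4)}{\ln(\delta+2)}-1}-(\delta+2)\big((\delta+1)k-2\delta\big)}{\delta(\delta+3)(\delta+1)k/2}\\ &\quad +\frac{2\delta}{(\delta+1)k}+\frac{\delta-1}{\delta+1}+\frac{2 (\delta(k-2)+k) \left(\frac{\ln \left((\delta (k-2)+k)/2\right)}{\ln (\delta +2)}+\delta +2\right)}{(\delta +1) (\delta +2) k}.\end{aligned}$$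
   Context: The degree of a vertex is its number of neighbors. $k_{\rm nn}(k)$ is the average, over all vertices $v$ of degree $k$, of $\frac1k\sum_{u\sim v}\deg(u)$ (the mean degree of the neighbors of $v$). The strength of a vertex $i$ in a weighted graph is $s_i=\sum_j w_{ij}$, the sum of the weights of its incident edges. The weighted graphs $\mathcal{W}_n$ ($n\ge 0$) are defined recursively for a fixed integer $\delta\ge1$. $\mathcal{W}_0$ is a triangle whose three edges have weight $1$. For $n\ge1$, $\mathcal{W}_n$ is obtained from $\mathcal{W}_{n-1}$ as follows: (I) for each vertex $i$ of $\mathcal{W}_{n-1}$, of strength $s_i$ in $\mathcal{W}_{n-1}$ (always an even integer), take $s_i/2$ new disjoint copies of $\mathcal{K}_2$ (two vertices joined by an edge of weight $1$) and join both vertices of each copy to $i$ by edges of weight $1$; (II) multiply the weight of every edge that already belonged to $\mathcal{W}_{n-1}$ by $1+\delta$. *)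

theory Defs
  imports Complex_Main
begin

text \<open>
  A simple weighted graph: edges are two-element sets of vertices.  Only the values of the
  weight function on edges are meaningful.
\<close>

record 'v wgraph =
  verts :: "'v set"
  edges :: "'v set set"
  wt :: "'v set \<Rightarrow> nat"

definition neighbors :: "'v wgraph \<Rightarrow> 'v \<Rightarrow> 'v set" where
  "neighbors G v = {u \<in> verts G. {v, u} \<in> edges G}"

definition degree :: "'v wgraph \<Rightarrow> 'v \<Rightarrow> nat" where
  "degree G v = card (neighbors G v)"

definition strength :: "'v wgraph \<Rightarrow> 'v \<Rightarrow> nat" where
  "strength G v = (\<Sum>u\<in>neighbors G v. wt G {v, u})"

definition verts_of_degree :: "'v wgraph \<Rightarrow> nat \<Rightarrow> 'v set" where
  "verts_of_degree G k = {v \<in> verts G. degree G v = k}"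

definition knn :: "'v wgraph \<Rightarrow> nat \<Rightarrow> real" where
  "knn G k =
     (\<Sum>v\<in>verts_of_degree G k. (1 / real k) * (\<Sum>u\<in>neighbors G v. real (degree G u)))
       / real (card (verts_of_degree G k))"

text \<open>
  Names for the vertices.  In generation \<open>n\<close>, the copy number \<open>c\<close> of the complete graph on two
  vertices that is attached to the vertex \<open>i\<close> has the vertices \<open>New n i c False\<close> and
  \<open>New n i c True\<close>.  The generation in the name keeps them distinct from all earlier vertices.
\<close>

datatype vtx = Root nat | New nat vtx nat bool

definition triangle :: "vtx wgraph" where
  "triangle =
     \<lparr> verts = {Root 0, Root 1, Root 2},
       edges = {{Root 0, Root 1}, {Root 0, Root 2}, {Root 1, Root 2}},
       wt = (\<lambda>_. 1) \<rparr>"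

text \<open>
  The pairs of a vertex \<open>i\<close> and a number \<open>c\<close> of a copy attached to it.  All strengths occurring
  in the construction are even, so the integer division is exact.
\<close>

definition attachments :: "'v wgraph \<Rightarrow> ('v \<times> nat) set" where
  "attachments G = {(i, c). i \<in> verts G \<and> c < strength G i div 2}"

definition grow :: "nat \<Rightarrow> nat \<Rightarrow> vtx wgraph \<Rightarrow> vtx wgraph" where
  "grow \<delta> n G =
     \<lparr> verts = verts G \<union> (\<Union>(i, c)\<in>attachments G. {New n i c False, New n i c True}),
       edges = edges G \<union>
         (\<Union>(i, c)\<in>attachments G.
            {{New n i c False, New n i c True}, {i, New n i c False}, {i, New n i c True}}),
       wt = (\<lambda>e. if e \<in> edges G then (1 + \<delta>) * wt G e else 1) \<rparr>"

primrec W :: "nat \<Rightarrow> nat \<Rightarrow> vtx wgraph" where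
  "W \<delta> 0 = triangle"
| "W \<delta> (Suc n) = grow \<delta> (Suc n) (W \<delta> n)"

end

theory Submission
  imports Defs
begin

text \<open>
  Write \<open>q = \<delta> + 2\<close>.  One growth step multiplies the strength of an old vertex by \<open>q\<close> and raises its
  degree by its strength, while new vertices have degree and strength \<open>2\<close>.  Hence a vertex born in
  generation \<open>m\<close> has strength \<open>s = 2 q ^ (n - m)\<close> in generation \<open>n\<close>, and its degree \<open>k\<close> satisfies
  \<open>(\<delta> + 1) k = 2 \<delta> + s\<close>; in particular the vertices of a given degree are those born in a given
  generation, and sums of degrees over neighbors reduce to sums of strengths over neighbors.  The
  latter sum \<open>e\<close> turns into \<open>q e + 2 s\<close> at an old vertex, and equals \<open>q s\<^sub>i + 2\<close> at each of the \<open>s\<^sub>i\<close>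
  vertices newly attached to \<open>i\<close>.  Its average over a new generation is therefore determined by
  \<open>\<Sum> s\<^sub>i\<close> and \<open>\<Sum> s\<^sub>i\<^sup>2\<close>, which satisfy linear recurrences, and its average over an old generation
  by iterating \<open>e \<mapsto> q e + 2 s\<close>.
\<close>

section \<open>Births, neighbor strengths and new vertices\<close>

primrec birth :: "vtx \<Rightarrow> nat" where
  "birth (Root a) = 0"
| "birth (New m i c b) = m"

definition neighbor_strength :: "'v wgraph \<Rightarrow> 'v \<Rightarrow> nat" where
  "neighbor_strength G v = (\<Sum>u\<in>neighbors G v. strength G u)"

text \<open>Written as the image of an injective map, so that sums over new vertices can be
  reindexed.\<close>

definition fresh_verts :: "nat \<Rightarrow> vtx wgraph \<Rightarrow> vtx set" where
  "fresh_verts n G = (\<lambda>((i, c), b). New n i c b) ` (attachments G \<times> UNIV)"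

section \<open>Combinatorics of one growth step\<close>

text \<open>The invariant of the construction. \<open>n\<close> is the generation about to be added,
  so \<open>birth_less\<close> makes the new names fresh, \<open>edges_subset\<close> keeps new
  vertices out of old edges, and \<open>even_strength\<close> makes the division in
  \<open>attachments\<close> exact.\<close>

locale growing_graph =
  fixes G :: "vtx wgraph" and n \<delta> :: nat
  assumes finite_verts: "finite (verts G)"
    and birth_less: "v \<in> verts G \<Longrightarrow> birth v < n"
    and edges_subset: "edges G \<subseteq> Pow (verts G)"
    and even_strength: "v \<in> verts G \<Longrightarrow> even (strength G v)"
begin

abbreviation G' :: "vtx wgraph" where
  "G' \<equiv> grow \<delta> n G"

lemma New_notin_verts [simp]: "New n i c b \<notin> verts G"
  using birth_less[of "New n i c b"] by auto

lemma New_notin_edge: "e \<in> edges G \<Longrightarrow> New n i c b \<notin> e"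
  using edges_subset New_notin_verts by blast

lemma not_edge [simp]: "{u, New n i c b} \<notin> edges G" "{New n i c b, u} \<notin> edges G"
  using New_notin_edge by blast+

lemma attachments_iff [simp]:
  "(i, c) \<in> attachments G \<longleftrightarrow> i \<in> verts G \<and> c < strength G i div 2"
  by (simp add: attachments_def)

lemma attachments_eq: "attachments G = Sigma (verts G) (\<lambda>i. {..<strength G i div 2})"
  by (auto simp: attachments_def)

lemma mem_fresh_verts: "v \<in> fresh_verts n G \<longleftrightarrow>
    (\<exists>i c b. v = New n i c b \<and> i \<in> verts G \<and> c < strength G i div 2)"
  unfolding fresh_verts_def image_iff Bex_def split_paired_Ex by (simp add: conj_commute conj_left_commute)

lemma finite_neighbors: "finite (neighbors G v)"
  using finite_verts by (simp add: neighbors_def)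

lemma finite_fresh_verts: "finite (fresh_verts n G)"
  using finite_verts by (simp add: fresh_verts_def attachments_eq)

lemma verts_fresh_disjoint: "verts G \<inter> fresh_verts n G = {}"
  by (auto simp: mem_fresh_verts)

lemma verts_grow: "verts G' = verts G \<union> fresh_verts n G"
proof -
  have "(\<Union>(i, c)\<in>attachments G. {New n i c False, New n i c True}) = fresh_verts n G"
  proof (intro set_eqI iffI)
    fix v assume "v \<in> fresh_verts n G"
    then obtain i c b where "v = New n i c b" "(i, c) \<in> attachments G"
      by (auto simp: mem_fresh_verts)
    then show "v \<in> (\<Union>(i, c)\<in>attachments G. {New n i c False, New n i c True})"
      by (cases b) auto
  qed (auto simp: mem_fresh_verts)
  then show ?thesis
    by (simp add: grow_def)
qed

lemma edges_grow_cases: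
  "e \<in> edges G' \<longleftrightarrow> e \<in> edges G \<or>
    (\<exists>i c. i \<in> verts G \<and> c < strength G i div 2 \<and>
      (e = {New n i c False, New n i c True} \<or> (\<exists>b. e = {i, New n i c b})))"
  by (simp add: grow_def Bex_def ex_bool_eq disj_commute disj_left_commute)

lemma edge_grow_old:
  assumes "v \<in> verts G" "u \<in> verts G"
  shows "{v, u} \<in> edges G' \<longleftrightarrow> {v, u} \<in> edges G"
  using assms by (auto simp: edges_grow_cases doubleton_eq_iff)

lemma edge_grow_old_new:
  assumes "v \<in> verts G"
  shows "{v, New n i c b} \<in> edges G' \<longleftrightarrow> v = i \<and> c < strength G i div 2"
  using assms by (auto simp: edges_grow_cases doubleton_eq_iff)

lemma edge_grow_new_new:
  assumes "i \<in> verts G" "c < strength G i div 2"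
  shows "{New n i c b, New n j d b'} \<in> edges G' \<longleftrightarrow> j = i \<and> d = c \<and> b' = (\<not> b)"
  using assms by (cases b; cases b') (auto simp: edges_grow_cases doubleton_eq_iff)

lemma edges_grow_subset: "edges G' \<subseteq> Pow (verts G')"
proof
  have *: "New n i c b \<in> verts G'" if "i \<in> verts G" "c < strength G i div 2" for i c b
    using that by (simp add: verts_grow mem_fresh_verts)
  have **: "i \<in> verts G'" if "i \<in> verts G" for i
    using that by (simp add: verts_grow)
  fix e assume "e \<in> edges G'"
  then show "e \<in> Pow (verts G')"
    unfolding edges_grow_cases using edges_subset * ** by blast
qed

lemma neighbors_grow_old:
  assumes "v \<in> verts G"
  shows "neighbors G' v = neighbors G v \<union>
    (\<lambda>(c, b). New n v c b) ` ({..<strength G v div 2} \<times> UNIV)" (is "_ = _ \<union> ?N")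
proof -
  have "u \<in> neighbors G' v \<longleftrightarrow> u \<in> neighbors G v \<union> ?N" for u
  proof (cases "u \<in> verts G")
    case True
    then show ?thesis
      using assms by (auto simp: neighbors_def verts_grow edge_grow_old)
  next
    case False
    then show ?thesis
      using assms
      by (auto simp: neighbors_def verts_grow mem_fresh_verts edge_grow_old_new image_iff)
  qed
  then show ?thesis by blast
qed

lemma neighbors_grow_new:
  assumes "i \<in> verts G" "c < strength G i div 2"
  shows "neighbors G' (New n i c b) = {i, New n i c (\<not> b)}"
proof -
  have "u \<in> neighbors G' (New n i c b) \<longleftrightarrow> u \<in> {i, New n i c (\<not> b)}" for u
  proof (cases "u \<in> verts G")
    case True
    then have "{New n i c b, u} \<in> edges G' \<longleftrightarrow> u = i"
      using assms edge_grow_old_new[of u i c b] by (auto simp: insert_commute)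
    with True show ?thesis
      using assms by (auto simp: neighbors_def verts_grow)
  next
    case False
    then show ?thesis
      using assms by (auto simp: neighbors_def verts_grow mem_fresh_verts edge_grow_new_new)
  qed
  then show ?thesis by blast
qed

text \<open>Each of the \<open>strength G v div 2\<close> copies contributes two new neighbors;
  evenness makes that \<open>strength G v\<close> in all. A general \<open>f\<close> serves degrees,
  strengths and neighbor strengths alike.\<close>

lemma sum_neighbors_grow_old:
  fixes f :: "vtx \<Rightarrow> nat"
  assumes "v \<in> verts G" and "\<And>c b. c < strength G v div 2 \<Longrightarrow> f (New n v c b) = a"
  shows "sum f (neighbors G' v) = sum f (neighbors G v) + strength G v * a"
proof -
  let ?N = "(\<lambda>(c, b). New n v c b) ` ({..<strength G v div 2} \<times> (UNIV :: bool set))"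
  have inj: "inj_on (\<lambda>(c, b). New n v c b) A" for A
    by (auto simp: inj_on_def)
  have "sum f ?N = (\<Sum>x\<in>{..<strength G v div 2} \<times> (UNIV :: bool set). a)"
    unfolding sum.reindex[OF inj] using assms(2) by (intro sum.cong) auto
  also have "\<dots> = strength G v * a"
    using even_strength[OF assms(1)] by (simp add: card_cartesian_product)
  finally have "sum f ?N = strength G v * a" .
  moreover have "neighbors G v \<inter> ?N = {}"
    by (auto simp: neighbors_def)
  ultimately show ?thesis
    using finite_neighbors
    by (simp add: neighbors_grow_old[OF assms(1)] sum.union_disjoint)
qed

section \<open>Weights, degrees and strengths after a growth step\<close>

lemma wt_grow_old:
  assumes "u \<in> neighbors G v"
  shows "wt G' {v, u} = (1 + \<delta>) * wt G {v, u}"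
  using assms by (simp add: neighbors_def grow_def)

lemma wt_grow_new: "wt G' {u, New n i c b} = 1" "wt G' {New n i c b, u} = 1"
  by (simp_all add: grow_def)

lemma degree_grow_old: "v \<in> verts G \<Longrightarrow> degree G' v = degree G v + strength G v"
  using sum_neighbors_grow_old[of v "\<lambda>_. 1" 1] by (simp add: degree_def)

lemma degree_grow_new:
  assumes "i \<in> verts G" "c < strength G i div 2"
  shows "degree G' (New n i c b) = 2"
proof -
  have "i \<noteq> New n i c (\<not> b)"
    using assms(1) by (metis New_notin_verts)
  then show ?thesis
    by (simp add: degree_def neighbors_grow_new[OF assms])
qed

text \<open>Old edges contribute \<open>(1 + \<delta>) s\<close>, and the \<open>s\<close> new edges
  of weight 1 contribute another \<open>s\<close>.\<close>

lemma strength_grow_old: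
  assumes "v \<in> verts G"
  shows "strength G' v = (\<delta> + 2) * strength G v"
proof -
  have "strength G' v = (\<Sum>u\<in>neighbors G v. wt G' {v, u}) + strength G v"
    unfolding strength_def[of G' v]
    using sum_neighbors_grow_old[OF assms, of "\<lambda>u. wt G' {v, u}" 1] by (simp add: wt_grow_new)
  also have "(\<Sum>u\<in>neighbors G v. wt G' {v, u}) = (1 + \<delta>) * strength G v"
    by (simp add: wt_grow_old strength_def sum_distrib_left)
  finally show ?thesis by simp
qed

lemma strength_grow_new:
  assumes "i \<in> verts G" "c < strength G i div 2"
  shows "strength G' (New n i c b) = 2"
  using degree_grow_new[OF assms, of b] by (simp add: strength_def degree_def wt_grow_new)

lemma neighbor_strength_grow_old:
  assumes "v \<in> verts G"
  shows "neighbor_strength G' v = (\<delta> + 2) * neighbor_strength G v + 2 * strength G v"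
proof -
  have "neighbor_strength G' v = (\<Sum>u\<in>neighbors G v. strength G' u) + strength G v * 2"
    unfolding neighbor_strength_def[of G' v] using assms
    by (intro sum_neighbors_grow_old) (auto simp: strength_grow_new)
  also have "(\<Sum>u\<in>neighbors G v. strength G' u) = (\<delta> + 2) * neighbor_strength G v"
    unfolding neighbor_strength_def sum_distrib_left
    by (intro sum.cong) (auto simp: neighbors_def strength_grow_old)
  finally show ?thesis by simp
qed

lemma neighbor_strength_grow_new:
  assumes "i \<in> verts G" "c < strength G i div 2"
  shows "neighbor_strength G' (New n i c b) = (\<delta> + 2) * strength G i + 2"
proof -
  have "i \<noteq> New n i c (\<not> b)"
    using assms(1) by (metis New_notin_verts)
  then show ?thesis
    using assms by (simp add: neighbor_strength_def neighbors_grow_new strength_grow_old strength_grow_new)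
qed

section \<open>Sums over the new vertices\<close>

text \<open>Vertex \<open>i\<close> is the parent of \<open>strength G i\<close> new vertices, so a
  quantity that depends only on the parent is summed with the strengths as weights. This is how the
  squares of strengths enter.\<close>

lemma sum_fresh_verts:
  fixes f g :: "vtx \<Rightarrow> nat"
  assumes "\<And>i c b. i \<in> verts G \<Longrightarrow> c < strength G i div 2 \<Longrightarrow> f (New n i c b) = g i"
  shows "sum f (fresh_verts n G) = (\<Sum>i\<in>verts G. strength G i * g i)"
proof -
  have inj: "inj_on (\<lambda>((i, c), b). New n i c b) A" for A
    by (auto simp: inj_on_def)
  have "sum f (fresh_verts n G) = (\<Sum>((i, c), b)\<in>attachments G \<times> UNIV. f (New n i c b))"
    unfolding fresh_verts_def sum.reindex[OF inj] by (intro sum.cong) auto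
  also have "\<dots> = (\<Sum>((i, c), b)\<in>attachments G \<times> (UNIV :: bool set). g i)"
    using assms by (intro sum.cong) auto
  also have "\<dots> = (\<Sum>x\<in>attachments G. \<Sum>b\<in>(UNIV :: bool set). g (fst x))"
    by (subst sum.cartesian_product) (simp add: case_prod_unfold)
  also have "\<dots> = (\<Sum>(i, c)\<in>attachments G. 2 * g i)"
    by (simp add: case_prod_unfold)
  also have "\<dots> = (\<Sum>i\<in>verts G. \<Sum>c<strength G i div 2. 2 * g i)"
    using finite_verts unfolding attachments_eq by (subst sum.Sigma) auto
  also have "\<dots> = (\<Sum>i\<in>verts G. strength G i * g i)"
    using even_strength by (intro sum.cong) auto
  finally show ?thesis .
qed

lemma sum_verts_grow:
  fixes f :: "vtx \<Rightarrow> nat"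
  shows "sum f (verts G') = sum f (verts G) + sum f (fresh_verts n G)"
  using finite_verts finite_fresh_verts verts_fresh_disjoint
  by (simp add: verts_grow sum.union_disjoint)

lemma card_fresh_verts: "card (fresh_verts n G) = sum (strength G) (verts G)"
  using sum_fresh_verts[of "\<lambda>_. 1" "\<lambda>_. 1"] by simp

lemma sum_strength_grow:
  "sum (strength G') (verts G') = (\<delta> + 4) * sum (strength G) (verts G)"
proof -
  have "sum (strength G') (verts G) = (\<delta> + 2) * sum (strength G) (verts G)"
    unfolding sum_distrib_left by (intro sum.cong strength_grow_old refl)
  moreover have "sum (strength G') (fresh_verts n G) = (\<Sum>i\<in>verts G. strength G i * 2)"
    by (intro sum_fresh_verts strength_grow_new)
  moreover have "(\<Sum>i\<in>verts G. strength G i * 2) = sum (strength G) (verts G) * 2"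
    by (rule sum_distrib_right[symmetric])
  ultimately show ?thesis
    unfolding sum_verts_grow by (simp add: algebra_simps)
qed

lemma sum_strength_squared_grow:
  "(\<Sum>v\<in>verts G'. (strength G' v)\<^sup>2) =
    (\<delta> + 2)\<^sup>2 * (\<Sum>v\<in>verts G. (strength G v)\<^sup>2) + 4 * sum (strength G) (verts G)"
proof -
  have "(\<Sum>v\<in>verts G. (strength G' v)\<^sup>2) = (\<delta> + 2)\<^sup>2 * (\<Sum>v\<in>verts G. (strength G v)\<^sup>2)"
    unfolding sum_distrib_left power_mult_distrib[symmetric]
    by (intro sum.cong refl) (simp only: strength_grow_old)
  moreover have "(\<Sum>v\<in>fresh_verts n G. (strength G' v)\<^sup>2) = (\<Sum>i\<in>verts G. strength G i * 4)"
    by (intro sum_fresh_verts) (simp add: strength_grow_new)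
  moreover have "(\<Sum>i\<in>verts G. strength G i * 4) = sum (strength G) (verts G) * 4"
    by (rule sum_distrib_right[symmetric])
  ultimately show ?thesis
    unfolding sum_verts_grow by simp
qed

lemma sum_neighbor_strength_fresh:
  "sum (neighbor_strength G') (fresh_verts n G) =
    (\<delta> + 2) * (\<Sum>v\<in>verts G. (strength G v)\<^sup>2) + 2 * sum (strength G) (verts G)"
proof -
  have "sum (neighbor_strength G') (fresh_verts n G) =
      (\<Sum>i\<in>verts G. strength G i * ((\<delta> + 2) * strength G i + 2))"
    by (intro sum_fresh_verts neighbor_strength_grow_new)
  also have "\<dots> = (\<Sum>i\<in>verts G. (\<delta> + 2) * (strength G i)\<^sup>2 + 2 * strength G i)"
    by (intro sum.cong) (auto simp: algebra_simps power2_eq_square)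
  finally show ?thesis
    by (simp only: sum.distrib sum_distrib_left)
qed

lemma growing_graph_grow: "growing_graph G' (Suc n)"
proof
  show "finite (verts G')"
    using finite_verts finite_fresh_verts by (simp add: verts_grow)
  show "birth v < Suc n" if "v \<in> verts G'" for v
    using that birth_less[of v] by (auto simp: verts_grow mem_fresh_verts)
  show "even (strength G' v)" if "v \<in> verts G'" for v
    using that even_strength[of v]
    by (auto simp: verts_grow mem_fresh_verts strength_grow_old strength_grow_new)
qed (rule edges_grow_subset)

end

section \<open>The initial triangle\<close>

lemma verts_triangle: "verts triangle = {Root 0, Root 1, Root 2}"
  by (simp add: triangle_def)

lemma neighbors_triangle:
  "v \<in> verts triangle \<Longrightarrow> neighbors triangle v = verts triangle - {v}"
  by (auto simp: triangle_def neighbors_def doubleton_eq_iff)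

lemma degree_triangle: "v \<in> verts triangle \<Longrightarrow> degree triangle v = 2"
  by (auto simp: degree_def neighbors_triangle) (auto simp: verts_triangle)

lemma strength_triangle: "v \<in> verts triangle \<Longrightarrow> strength triangle v = 2"
  using degree_triangle[of v] by (simp add: strength_def degree_def triangle_def)

lemma neighbor_strength_triangle:
  assumes "v \<in> verts triangle"
  shows "neighbor_strength triangle v = 4"
proof -
  have "neighbor_strength triangle v = (\<Sum>u\<in>neighbors triangle v. 2)"
    unfolding neighbor_strength_def
    by (intro sum.cong) (auto simp: neighbors_def strength_triangle)
  with degree_triangle[OF assms] show ?thesis
    by (simp add: degree_def)
qed

section \<open>Strengths, degrees and their sums in generation \<open>n\<close>\<close>

lemma growing_graph_W: "growing_graph (W \<delta> n) (Suc n)"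
proof (induction n)
  case 0
  show ?case
  proof
    show "birth v < Suc 0" if "v \<in> verts (W \<delta> 0)" for v
      using that by (auto simp: verts_triangle)
  qed (auto simp: strength_triangle, auto simp: triangle_def)
next
  case (Suc n)
  then show ?case
    by (simp add: growing_graph.growing_graph_grow)
qed

lemma strength_W: "v \<in> verts (W \<delta> n) \<Longrightarrow> strength (W \<delta> n) v = 2 * (\<delta> + 2) ^ (n - birth v)"
proof (induction n)
  case 0
  then show ?case
    by (simp add: strength_triangle)
next
  case (Suc n)
  interpret growing_graph "W \<delta> n" "Suc n" \<delta>
    by (rule growing_graph_W)
  show ?case
  proof (cases "v \<in> verts (W \<delta> n)")
    case True
    \<comment> \<open>An old vertex has birth at most \<open>n\<close>, so the truncated exponent
      really grows by one.\<close>
    with birth_less[OF True] Suc.IH show ?thesis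
      by (simp add: strength_grow_old Suc_diff_le)
  next
    case False
    with Suc.prems show ?thesis
      by (auto simp: verts_grow mem_fresh_verts strength_grow_new)
  qed
qed

text \<open>In each step the degree gains \<open>s\<close> and the strength gains
  \<open>(\<delta> + 1) s\<close>, so \<open>(\<delta> + 1) k - s\<close> never changes; at birth it
  is \<open>2 (\<delta> + 1) - 2 = 2 \<delta>\<close>.\<close>

lemma degree_W:
  "v \<in> verts (W \<delta> n) \<Longrightarrow> (\<delta> + 1) * degree (W \<delta> n) v = 2 * \<delta> + strength (W \<delta> n) v"
proof (induction n)
  case 0
  then show ?case
    by (simp add: strength_triangle degree_triangle)
next
  case (Suc n)
  interpret growing_graph "W \<delta> n" "Suc n" \<delta>
    by (rule growing_graph_W)
  show ?case
  proof (cases "v \<in> verts (W \<delta> n)")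
    case True
    with Suc.IH show ?thesis
      by (simp add: strength_grow_old degree_grow_old algebra_simps)
  next
    case False
    with Suc.prems show ?thesis
      by (auto simp: verts_grow mem_fresh_verts strength_grow_new degree_grow_new)
  qed
qed

lemma sum_strength_W: "sum (strength (W \<delta> n)) (verts (W \<delta> n)) = 6 * (\<delta> + 4) ^ n"
proof (induction n)
  case 0
  show ?case
    by (simp add: strength_triangle) (simp add: verts_triangle)
next
  case (Suc n)
  then show ?case
    by (simp add: growing_graph.sum_strength_grow[OF growing_graph_W])
qed

text \<open>The recurrence has the particular solution
  \<open>- 24 (\<delta> + 4) ^ n / (\<delta> (\<delta> + 3))\<close>, because
  \<open>(\<delta> + 2)^2 - (\<delta> + 4) = \<delta> (\<delta> + 3)\<close>. Subtracting it leaves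
  a geometric sequence of ratio \<open>(\<delta> + 2)^2\<close>. Cleared of denominators and
  differences, this stays in \<open>nat\<close>.\<close>

lemma sum_strength_squared_W:
  "\<delta> * (\<delta> + 3) * (\<Sum>v\<in>verts (W \<delta> n). (strength (W \<delta> n) v)\<^sup>2) + 24 * (\<delta> + 4) ^ n =
    12 * (\<delta> + 1) * (\<delta> + 2) ^ (2 * n + 1)"
proof (induction n)
  case 0
  have "(\<Sum>v\<in>verts (W \<delta> 0). (strength (W \<delta> 0) v)\<^sup>2) = 12"
    by (simp add: strength_triangle) (simp add: verts_triangle)
  then show ?case
    by (simp add: algebra_simps)
next
  case (Suc n)
  let ?S = "\<Sum>v\<in>verts (W \<delta> n). (strength (W \<delta> n) v)\<^sup>2"
  have "(\<Sum>v\<in>verts (W \<delta> (Suc n)). (strength (W \<delta> (Suc n)) v)\<^sup>2) =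
      (\<delta> + 2)\<^sup>2 * ?S + 4 * (6 * (\<delta> + 4) ^ n)"
    by (simp only: W.simps growing_graph.sum_strength_squared_grow[OF growing_graph_W]
        sum_strength_W)
  moreover have "\<delta> * (\<delta> + 3) * ((\<delta> + 2)\<^sup>2 * ?S + 4 * (6 * (\<delta> + 4) ^ n)) + 24 * (\<delta> + 4) ^ Suc n =
      (\<delta> + 2)\<^sup>2 * (\<delta> * (\<delta> + 3) * ?S + 24 * (\<delta> + 4) ^ n)"
    by (simp add: algebra_simps power2_eq_square)
  moreover have "(\<delta> + 2)\<^sup>2 * (12 * (\<delta> + 1) * (\<delta> + 2) ^ (2 * n + 1)) =
      12 * (\<delta> + 1) * (\<delta> + 2) ^ (2 * Suc n + 1)"
  proof -
    have "2 * Suc n + 1 = 2 + (2 * n + 1)" by simp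
    then show ?thesis
      by (simp only: power_add ac_simps)
  qed
  ultimately show ?case
    using Suc.IH by simp
qed

section \<open>Mean neighbor strength of a generation\<close>

definition born :: "vtx wgraph \<Rightarrow> nat \<Rightarrow> vtx set" where
  "born G m = {v \<in> verts G. birth v = m}"

lemma born_W_Suc_old: "m \<le> n \<Longrightarrow> born (W \<delta> (Suc n)) m = born (W \<delta> n) m"
  using growing_graph.verts_grow[OF growing_graph_W, of \<delta> n \<delta>]
  by (auto simp: born_def growing_graph.mem_fresh_verts[OF growing_graph_W])

lemma born_W_Suc_new: "born (W \<delta> (Suc n)) (Suc n) = fresh_verts (Suc n) (W \<delta> n)"
proof -
  interpret growing_graph "W \<delta> n" "Suc n" \<delta>
    by (rule growing_graph_W)
  show ?thesis
    using birth_less by (fastforce simp: born_def verts_grow mem_fresh_verts)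
qed

text \<open>
  For \<open>m \<ge> 1\<close> this is \<open>(\<delta> + 2) S\<^sub>2 / S\<^sub>1 + 2\<close>, where \<open>S\<^sub>1\<close> and \<open>S\<^sub>2\<close> are the sums of the strengths and of
  their squares in generation \<open>m - 1\<close>.  At \<open>m = 0\<close> the same formula gives \<open>4\<close>, the value for the
  triangle, so the roots need no separate treatment.
\<close>

definition birth_mean :: "nat \<Rightarrow> nat \<Rightarrow> real" where
  "birth_mean \<delta> m = 2 - 4 * (\<delta> + 2) / (\<delta> * (\<delta> + 3)) +
    2 * ((\<delta> + 1) * (\<delta> + 4) * ((\<delta> + 2) ^ (2 * m) / (\<delta> + 4) ^ m)) / (\<delta> * (\<delta> + 3))"

text \<open>The product form avoids dividing by a cardinality, which for \<open>m = Suc j\<close> is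
  the total strength in generation \<open>j\<close>.\<close>

lemma sum_neighbor_strength_born:
  assumes "\<delta> \<ge> 1"
  shows "real (sum (neighbor_strength (W \<delta> m)) (born (W \<delta> m) m)) =
    real (card (born (W \<delta> m) m)) * birth_mean \<delta> m"
proof (cases m)
  case 0
  have "born (W \<delta> 0) 0 = verts triangle"
    by (auto simp: born_def verts_triangle)
  moreover have "sum (neighbor_strength triangle) (verts triangle) = card (verts triangle) * 4"
    by (simp add: neighbor_strength_triangle)
  moreover have "birth_mean \<delta> 0 = 4"
    using assms by (simp add: birth_mean_def divide_simps) (simp add: algebra_simps)
  ultimately show ?thesis
    by (simp add: 0)
next
  case (Suc j)
  interpret growing_graph "W \<delta> j" "Suc j" \<delta>
    by (rule growing_graph_W)
  define S where "S = (\<Sum>v\<in>verts (W \<delta> j). (strength (W \<delta> j) v)\<^sup>2)"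
  let ?d = "real \<delta>"
  have d: "?d > 0" using assms by simp
  have "real (\<delta> * (\<delta> + 3) * S + 24 * (\<delta> + 4) ^ j) = real (12 * (\<delta> + 1) * (\<delta> + 2) ^ (2 * j + 1))"
    unfolding S_def sum_strength_squared_W ..
  then have "?d * (?d + 3) * S + 24 * (?d + 4) ^ j = 12 * (?d + 1) * (?d + 2) ^ (2 * j + 1)"
    by (simp add: algebra_simps)
  then have "real S * (?d * (?d + 3)) = 12 * (?d + 1) * (?d + 2) ^ (2 * j + 1) - 24 * (?d + 4) ^ j"
    by (simp only: eq_diff_eq mult.commute)
  then have S: "real S = (12 * (?d + 1) * (?d + 2) ^ (2 * j + 1) - 24 * (?d + 4) ^ j) / (?d * (?d + 3))"
    using d by (intro eq_divide_imp) auto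
  have p: "(?d + 4) ^ j > 0" using d by simp
  have "real (card (born (W \<delta> m) m)) * birth_mean \<delta> m = 6 * (?d + 4) ^ j * birth_mean \<delta> (Suc j)"
    unfolding Suc born_W_Suc_new card_fresh_verts sum_strength_W by (simp add: add.commute)
  also have "\<dots> = (?d + 2) * S + 12 * (?d + 4) ^ j"
    unfolding S birth_mean_def using d p
    by (simp add: divide_simps) (simp add: algebra_simps)
  also have "\<dots> = real (sum (neighbor_strength (W \<delta> m)) (born (W \<delta> m) m))"
    unfolding Suc born_W_Suc_new
    unfolding W.simps sum_neighbor_strength_fresh sum_strength_W S_def[symmetric]
    by (simp add: algebra_simps)
  finally show ?thesis ..
qed

text \<open>At age \<open>t\<close> the strength is \<open>2 q ^ t\<close> with
  \<open>q = \<delta> + 2\<close>, so the iteration reads \<open>e \<mapsto> q e + 4 q ^ t\<close>: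
  the mean divided by \<open>q ^ t\<close> grows by \<open>4 / q\<close> in every step.\<close>

lemma sum_neighbor_strength_born_W:
  assumes "\<delta> \<ge> 1"
  shows "real (sum (neighbor_strength (W \<delta> (m + t))) (born (W \<delta> (m + t)) m)) =
    real (card (born (W \<delta> (m + t)) m)) *
      (real (\<delta> + 2) ^ t * (birth_mean \<delta> m + 4 * real t / real (\<delta> + 2)))"
proof (induction t)
  case 0
  then show ?case
    using sum_neighbor_strength_born[OF assms] by simp
next
  case (Suc t)
  let ?B = "born (W \<delta> (m + t)) m"
  have B: "born (W \<delta> (m + Suc t)) m = ?B"
    using born_W_Suc_old[of m "m + t"] by simp
  have "neighbor_strength (W \<delta> (m + Suc t)) v =
      (\<delta> + 2) * neighbor_strength (W \<delta> (m + t)) v + 4 * (\<delta> + 2) ^ t" if "v \<in> ?B" for v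
    using that growing_graph.neighbor_strength_grow_old[OF growing_graph_W] strength_W[of v \<delta> "m + t"]
    by (simp add: born_def)
  then have "sum (neighbor_strength (W \<delta> (m + Suc t))) ?B =
      (\<delta> + 2) * sum (neighbor_strength (W \<delta> (m + t))) ?B + card ?B * (4 * (\<delta> + 2) ^ t)"
    by (simp add: sum.distrib sum_distrib_left del: W.simps add_Suc_right)
  then have "real (sum (neighbor_strength (W \<delta> (m + Suc t))) ?B) =
      real (\<delta> + 2) * real (sum (neighbor_strength (W \<delta> (m + t))) ?B)
        + real (card ?B) * (4 * real (\<delta> + 2) ^ t)"
    by (simp only: of_nat_add of_nat_mult of_nat_power of_nat_numeral)
  then show ?case
    unfolding B Suc.IH by (simp add: field_simps)
qed

section \<open>From neighbor strengths to neighbor degrees\<close>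

text \<open>The affine relation \<open>degree_W\<close> is summed over the neighbors; its constant
  \<open>2 \<delta>\<close> occurs once per neighbor, whence the factor
  \<open>degree\<close>.\<close>

lemma sum_degree_neighbors_W:
  assumes "v \<in> verts (W \<delta> n)"
  shows "(\<Sum>u\<in>neighbors (W \<delta> n) v. real (degree (W \<delta> n) u)) =
    (2 * real \<delta> * real (degree (W \<delta> n) v) + real (neighbor_strength (W \<delta> n) v)) / (real \<delta> + 1)"
proof -
  have "real (degree (W \<delta> n) u) = (2 * real \<delta> + real (strength (W \<delta> n) u)) / (real \<delta> + 1)"
    if "u \<in> neighbors (W \<delta> n) v" for u
  proof -
    have "real ((\<delta> + 1) * degree (W \<delta> n) u) = real (2 * \<delta> + strength (W \<delta> n) u)"
      using that degree_W[of u] by (simp add: neighbors_def)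
    then show ?thesis
      by (simp add: field_simps)
  qed
  then show ?thesis
    by (simp add: sum_divide_distrib[symmetric] sum.distrib degree_def neighbor_strength_def)
qed

text \<open>Here \<open>m\<close> is the birth generation and \<open>t\<close> the age of a witness
  \<open>v\<close>. The degree determines the age, so the vertices of degree \<open>k\<close> form
  one whole generation, over which the mean is known.\<close>

lemma knn_W:
  assumes "\<delta> \<ge> 1" and v: "v \<in> verts (W \<delta> (m + t))" "birth v = m" "degree (W \<delta> (m + t)) v = k"
  shows "real k = (2 * real \<delta> + 2 * (real \<delta> + 2) ^ t) / (real \<delta> + 1)"
    and "knn (W \<delta> (m + t)) k =
      (2 * real \<delta> * real k + (real \<delta> + 2) ^ t * (birth_mean \<delta> m + 4 * real t / (real \<delta> + 2)))
        / (real k * (real \<delta> + 1))"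
proof -
  let ?G = "W \<delta> (m + t)"
  let ?B = "born ?G m"
  have deg: "(\<delta> + 1) * degree ?G u = 2 * \<delta> + 2 * (\<delta> + 2) ^ (m + t - birth u)" if "u \<in> verts ?G" for u
    using degree_W[OF that] strength_W[OF that] by simp
  have "real ((\<delta> + 1) * k) = real (2 * \<delta> + 2 * (\<delta> + 2) ^ t)"
    using deg[OF v(1)] v by simp
  then show "real k = (2 * real \<delta> + 2 * (real \<delta> + 2) ^ t) / (real \<delta> + 1)"
    by (simp add: field_simps)
  have "degree ?G u = k \<longleftrightarrow> birth u = m" if u: "u \<in> verts ?G" for u
  proof
    assume "birth u = m"
    then show "degree ?G u = k"
      using deg[OF u] deg[OF v(1)] v by (metis add_gr_0 less_numeral_extra(1) mult_left_cancel neq0_conv)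
  next
    assume "degree ?G u = k"
    then have "(\<delta> + 2) ^ (m + t - birth u) = (\<delta> + 2) ^ (m + t - birth v)"
      using deg[OF u] deg[OF v(1)] v by simp
    then have "m + t - birth u = m + t - birth v"
      by simp
    \<comment> \<open>Both births are at most \<open>m + t\<close>, so the truncated differences are
      exact.\<close>
    then show "birth u = m"
      using growing_graph.birth_less[OF growing_graph_W u] growing_graph.birth_less[OF growing_graph_W v(1)] v
      by linarith
  qed
  then have B: "verts_of_degree ?G k = ?B"
    by (auto simp: verts_of_degree_def born_def)
  have "finite ?B" "v \<in> ?B"
    using growing_graph.finite_verts[OF growing_graph_W] v by (auto simp: born_def)
  then have card: "real (card ?B) > 0"
    by (auto simp: card_gt_0_iff)
  have "(\<Sum>u\<in>?B. 1 / real k * (\<Sum>w\<in>neighbors ?G u. real (degree ?G w))) =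
      (\<Sum>u\<in>?B. (2 * real \<delta> * real k + real (neighbor_strength ?G u)) / (real k * (real \<delta> + 1)))"
  proof (rule sum.cong)
    fix u assume "u \<in> ?B"
    then have "u \<in> verts ?G" "degree ?G u = k"
      unfolding B[symmetric] by (auto simp: verts_of_degree_def)
    then show "1 / real k * (\<Sum>w\<in>neighbors ?G u. real (degree ?G w)) =
        (2 * real \<delta> * real k + real (neighbor_strength ?G u)) / (real k * (real \<delta> + 1))"
      by (simp add: sum_degree_neighbors_W)
  qed simp
  also have "\<dots> = (real (card ?B) * (2 * real \<delta> * real k) + real (sum (neighbor_strength ?G) ?B))
      / (real k * (real \<delta> + 1))"
    by (simp add: sum_divide_distrib[symmetric] sum.distrib)
  also have "\<dots> = real (card ?B) * ((2 * real \<delta> * real k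
      + (real \<delta> + 2) ^ t * (birth_mean \<delta> m + 4 * real t / (real \<delta> + 2))) / (real k * (real \<delta> + 1)))"
    unfolding sum_neighbor_strength_born_W[OF assms(1)] by (simp add: algebra_simps)
  finally show "knn ?G k =
      (2 * real \<delta> * real k + (real \<delta> + 2) ^ t * (birth_mean \<delta> m + 4 * real t / (real \<delta> + 2)))
        / (real k * (real \<delta> + 1))"
    unfolding knn_def B using card by simp
qed

section \<open>The formula in terms of the degree\<close>

theorem proposition3p7:
  fixes \<delta> n k :: nat
  assumes "\<delta> \<ge> 1"
    and "\<exists>v \<in> verts (W \<delta> n). degree (W \<delta> n) v = k"
  shows "knn (W \<delta> n) k =
    ((real \<delta> + 1) * (real \<delta> + 2) ^ (2 * n) * (real \<delta> + 4) powi (1 - int n)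
        * (((real \<delta> + 1) * real k - 2 * real \<delta>) / 2)
            powr (ln (real \<delta> + 4) / ln (real \<delta> + 2) - 1)
      - (real \<delta> + 2) * ((real \<delta> + 1) * real k - 2 * real \<delta>))
      / (real \<delta> * (real \<delta> + 3) * (real \<delta> + 1) * real k / 2)
    + 2 * real \<delta> / ((real \<delta> + 1) * real k)
    + (real \<delta> - 1) / (real \<delta> + 1)
    + 2 * (real \<delta> * (real k - 2) + real k)
        * (ln ((real \<delta> * (real k - 2) + real k) / 2) / ln (real \<delta> + 2) + real \<delta> + 2)
      / ((real \<delta> + 1) * (real \<delta> + 2) * real k)"
proof -
  obtain v where v: "v \<in> verts (W \<delta> n)" "degree (W \<delta> n) v = k"
    using assms(2) by blast
  define m t where "m = birth v" and "t = n - m"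
  have n: "n = m + t"
    using growing_graph.birth_less[OF growing_graph_W v(1)] by (simp add: m_def t_def)
  define d where "d = real \<delta>"
  have d: "d > 0" using assms(1) by (simp add: d_def)
  have v': "v \<in> verts (W \<delta> (m + t))" "birth v = m" "degree (W \<delta> (m + t)) v = k"
    using v n by (simp_all add: m_def)
  note nn = knn_W[OF assms(1) v', folded d_def]
  \<comment> \<open>This expression and the one in \<open>s'\<close> are both the strength of
    \<open>v\<close>, so the logarithm of its half to base \<open>d + 2\<close> returns the age
    \<open>t\<close>.\<close>
  have s: "(d + 1) * real k - 2 * d = 2 * (d + 2) ^ t"
    using d nn(1) by (simp add: field_simps)
  then have s': "d * (real k - 2) + real k = 2 * (d + 2) ^ t"
    by (simp add: algebra_simps)
  have "0 < (d + 1) * real k"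
    using s d by (smt (verit) zero_less_power)
  then have k: "real k > 0"
    using d by (simp add: zero_less_mult_iff)
  have log: "ln ((d + 2) ^ t) / ln (d + 2) = real t"
    using d by (simp add: ln_realpow)
  \<comment> \<open>Change of base: \<open>d + 2\<close> raised to
    \<open>ln (d + 4) / ln (d + 2)\<close> is \<open>d + 4\<close>.\<close>
  have "((d + 2) ^ t) powr (ln (d + 4) / ln (d + 2)) = (d + 4) ^ t"
  proof -
    have "((d + 2) ^ t) powr (ln (d + 4) / ln (d + 2)) = exp (real t * ln (d + 4))"
      using d by (simp add: powr_def ln_realpow)
    then show ?thesis
      using d by (simp add: exp_of_nat_mult)
  qed
  then have pw: "((d + 2) ^ t) powr (ln (d + 4) / ln (d + 2) - 1) = (d + 4) ^ t / (d + 2) ^ t"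
    using d by (simp add: powr_diff)
  have pi: "(d + 4) powi (1 - int n) = (d + 4) / ((d + 4) ^ m * (d + 4) ^ t)"
    using d by (simp add: n power_int_diff power_int_add)
  have "(d + 2) ^ (2 * n) = (d + 2) ^ (2 * m) * ((d + 2) ^ t * (d + 2) ^ t)"
    by (simp add: n power_add mult_2)
  \<comment> \<open>With \<open>n = m + t\<close> the factors \<open>(d + 4) ^ t\<close> cancel and
    one of the two factors \<open>(d + 2) ^ t\<close> survives, times the power term of
    \<open>birth_mean\<close>.\<close>
  then have "(d + 1) * (d + 2) ^ (2 * n) * (d + 4) powi (1 - int n) * ((d + 4) ^ t / (d + 2) ^ t) =
      (d + 2) ^ t * ((d + 1) * (d + 4) * ((d + 2) ^ (2 * m) / (d + 4) ^ m))"
    unfolding pi using d by (simp add: field_simps)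
  moreover have "birth_mean \<delta> m = 2 - 4 * (d + 2) / (d * (d + 3)) +
      2 * ((d + 1) * (d + 4) * ((d + 2) ^ (2 * m) / (d + 4) ^ m)) / (d * (d + 3))"
    by (simp add: birth_mean_def d_def add.commute)
  moreover define y where "y = (d + 1) * (d + 4) * ((d + 2) ^ (2 * m) / (d + 4) ^ m)"
  ultimately have
    y: "(d + 1) * (d + 2) ^ (2 * n) * (d + 4) powi (1 - int n) * ((d + 4) ^ t / (d + 2) ^ t) =
      (d + 2) ^ t * y"
    and mean: "birth_mean \<delta> m = 2 - 4 * (d + 2) / (d * (d + 3)) + 2 * y / (d * (d + 3))"
    by simp_all
  define x where "x = (d + 2) ^ t"
  have x: "2 * x = (d + 1) * real k - 2 * d"
    using s by (simp add: x_def)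
  have main: "(2 * d * real k + x * (2 - 4 * (d + 2) / (d * (d + 3)) + 2 * y / (d * (d + 3))
        + 4 * real t / (d + 2))) / (real k * (d + 1)) =
      (x * y - (d + 2) * (2 * x)) / (d * (d + 3) * (d + 1) * real k / 2)
      + 2 * d / ((d + 1) * real k) + (d - 1) / (d + 1)
      + 2 * (2 * x) * (real t + d + 2) / ((d + 1) * (d + 2) * real k)"
  proof -
    \<comment> \<open>Splitting \<open>2 d k = (d + 1) k + (d - 1) k\<close> and replacing
      \<open>(d + 1) k\<close> by \<open>2 d + 2 x\<close> produces the summands
      \<open>2 d / ((d + 1) k)\<close> and \<open>(d - 1) / (d + 1)\<close>. The remaining
      \<open>2 x\<close> joins the \<open>2 x\<close> from the mean.\<close>
    have "2 * d * real k = 2 * d + (d - 1) * real k + 2 * x"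
      using x by (simp add: algebra_simps)
    moreover have "x * (2 - 4 * (d + 2) / D + 2 * y / D + 4 * real t / D') =
        2 * x + x * (2 * y - 4 * (d + 2)) / D + 4 * x * real t / D'" for D D' :: real
      by (simp add: algebra_simps add_divide_distrib diff_divide_distrib)
    ultimately have "(2 * d * real k + x * (2 - 4 * (d + 2) / (d * (d + 3)) + 2 * y / (d * (d + 3))
        + 4 * real t / (d + 2))) / (real k * (d + 1)) =
      (2 * d + (d - 1) * real k + 4 * x + x * (2 * y - 4 * (d + 2)) / (d * (d + 3))
        + 4 * x * real t / (d + 2)) / (real k * (d + 1))"
      by simp
    also have "\<dots> = (x * y - (d + 2) * (2 * x)) / (d * (d + 3) * (d + 1) * real k / 2)
      + 2 * d / ((d + 1) * real k) + (d - 1) / (d + 1)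
      + 2 * (2 * x) * (real t + d + 2) / ((d + 1) * (d + 2) * real k)"
      using d k by (simp add: divide_simps) (simp add: algebra_simps)
    finally show ?thesis .
  qed
  have half: "2 * (d + 2) ^ t / 2 = (d + 2) ^ t"
    by simp
  show ?thesis
    using main nn(2)
    unfolding d_def[symmetric] s s' half log pw y mean x_def n[symmetric] by (rule trans[rotated])
qed

end
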